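(* Let $(X,d)$ be a metric space and let $C(X)$ be the collection of nonempty closed subsets of $X$. Let $\tau_{V^+}$ and $\tau_{H^+}$ be the upper Vietoris topology and the upper Hausdorff metric topology on $C(X)$. Then $\tau_{V^+}\subset\tau_{H^+}$ if and only if each nonempty closed subset of $X$ has the property $I$.
   Context: For $A\subset X$ and $\epsilon>0$, $B(A,\epsilon)=\bigcup_{a\in A}B(a,\epsilon)$ is the union of open $\epsilon$-balls centered at points of $A$, and $A^+=\{C\in C(X):C\subset A\}$. The upper Vietoris topology $\tau_{V^+}$ on $C(X)$ has as a base all sets $U^+$ with $U$ a nonempty open subset of $X$. The upper Hausdorff metric topology $\tau_{H^+}$ on $C(X)$ is the topology having, as a local (neighborhood) base at $A\in C(X)$, the sets $B_{H^+}(A,\epsilon)=\{C\in C(X):C\subset B(A,\epsilon)\}$, $\epsilon>0$. A nonempty subset $A$ of $X$ has the property $I$ if for each open $U\subset X$ with $A\subset U$, $\inf\{d(a,U^c):a\in A\}>0$, where $U^c=X\setminus U$ and $d(a,\emptyset)=+\infty$. *)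

theory Defs
  imports "HOL-Analysis.Analysis"
begin

context Metric_space
begin

definition hyperspace :: "'a set set" where
  "hyperspace = {C. closedin mtopology C \<and> C \<noteq> {}}"

definition upper :: "'a set \<Rightarrow> 'a set set" where
  "upper A = {C \<in> hyperspace. C \<subseteq> A}"

definition enlargement :: "'a set \<Rightarrow> real \<Rightarrow> 'a set" where
  "enlargement A \<epsilon> = (\<Union>a\<in>A. mball a \<epsilon>)"

definition upper_vietoris :: "'a set topology" where
  "upper_vietoris =
     topology (arbitrary union_of (\<lambda>\<U>. \<exists>U. openin mtopology U \<and> U \<noteq> {} \<and> \<U> = upper U))"

definition upper_hausdorff_ball :: "'a set \<Rightarrow> real \<Rightarrow> 'a set set" where
  "upper_hausdorff_ball A \<epsilon> = {C \<in> hyperspace. C \<subseteq> enlargement A \<epsilon>}"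

(* The sets upper_hausdorff_ball A \<epsilon> need not be open in this topology: they form a local base
   at A in the sense of neighbourhoods, see upper_hausdorff_ball_neighbourhood below. *)
definition upper_hausdorff :: "'a set topology" where
  "upper_hausdorff =
     topology (\<lambda>\<U>. \<U> \<subseteq> hyperspace \<and> (\<forall>A\<in>\<U>. \<exists>\<epsilon>>0. upper_hausdorff_ball A \<epsilon> \<subseteq> \<U>))"

(* Extended-real valued, so that the distance to the empty set is \<infinity>. *)
definition point_set_dist :: "'a \<Rightarrow> 'a set \<Rightarrow> ereal" where
  "point_set_dist a S = (INF y\<in>S. ereal (d a y))"

definition property_I :: "'a set \<Rightarrow> bool" where
  "property_I A \<longleftrightarrow> A \<noteq> {} \<and> A \<subseteq> M \<and>
     (\<forall>U. openin mtopology U \<and> A \<subseteq> U \<longrightarrow> (INF a\<in>A. point_set_dist a (M - U)) > 0)"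

lemma point_set_dist_empty: "point_set_dist a {} = \<infinity>"
  by (simp add: point_set_dist_def top_ereal_def)

lemma openin_upper_vietoris:
  "openin upper_vietoris =
     arbitrary union_of (\<lambda>\<U>. \<exists>U. openin mtopology U \<and> U \<noteq> {} \<and> \<U> = upper U)"
  (is "_ = arbitrary union_of ?P")
proof -
  have "(arbitrary union_of ?P) (\<U> \<inter> \<V>)" if P: "?P \<U>" "?P \<V>" for \<U> \<V>
  proof -
    obtain U V where UV: "openin mtopology U" "\<U> = upper U" "openin mtopology V" "\<V> = upper V"
      using P by blast
    have eq: "\<U> \<inter> \<V> = upper (U \<inter> V)"
      using UV by (auto simp: upper_def)
    show ?thesis
    proof (cases "U \<inter> V = {}")
      case True
      then have "\<U> \<inter> \<V> = {}"
        by (auto simp: eq upper_def hyperspace_def)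
      then show ?thesis
        by simp
    next
      case False
      then have "?P (\<U> \<inter> \<V>)"
        using UV eq by blast
      then show ?thesis
        by (simp add: arbitrary_union_of_inc)
    qed
  qed
  then have "istopology (arbitrary union_of ?P)"
    by (simp add: istopology_base_eq)
  then show ?thesis
    by (simp add: upper_vietoris_def)
qed

lemma hyperspace_subset: "C \<in> hyperspace \<Longrightarrow> C \<subseteq> M"
  by (auto simp: hyperspace_def closedin_def)

lemma enlargement_mono: "\<delta> \<le> \<epsilon> \<Longrightarrow> enlargement A \<delta> \<subseteq> enlargement A \<epsilon>"
  unfolding enlargement_def using mball_subset_concentric by blast

lemma subset_enlargement: "A \<subseteq> M \<Longrightarrow> \<epsilon> > 0 \<Longrightarrow> A \<subseteq> enlargement A \<epsilon>"
  by (force simp: enlargement_def)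

lemma enlargement_enlargement:
  "enlargement (enlargement A \<delta>) \<epsilon> \<subseteq> enlargement A (\<delta> + \<epsilon>)"
proof
  fix x assume "x \<in> enlargement (enlargement A \<delta>) \<epsilon>"
  then obtain a y where *: "a \<in> A" "a \<in> M" "y \<in> M" "x \<in> M" "d a y < \<delta>" "d y x < \<epsilon>"
    by (auto simp: enlargement_def)
  then have "d a x < \<delta> + \<epsilon>"
    using triangle[of a y x] by linarith
  with * show "x \<in> enlargement A (\<delta> + \<epsilon>)"
    by (auto simp: enlargement_def)
qed

lemma openin_upper_hausdorff:
  "openin upper_hausdorff \<U> \<longleftrightarrow>
     \<U> \<subseteq> hyperspace \<and> (\<forall>A\<in>\<U>. \<exists>\<epsilon>>0. upper_hausdorff_ball A \<epsilon> \<subseteq> \<U>)"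
proof -
  have "istopology (\<lambda>\<U>. \<U> \<subseteq> hyperspace \<and> (\<forall>A\<in>\<U>. \<exists>\<epsilon>>0. upper_hausdorff_ball A \<epsilon> \<subseteq> \<U>))"
    unfolding istopology_def
  proof (intro conjI allI impI ballI)
    fix \<U> \<V> A
    assume U: "\<U> \<subseteq> hyperspace \<and> (\<forall>A\<in>\<U>. \<exists>\<epsilon>>0. upper_hausdorff_ball A \<epsilon> \<subseteq> \<U>)"
      and V: "\<V> \<subseteq> hyperspace \<and> (\<forall>A\<in>\<V>. \<exists>\<epsilon>>0. upper_hausdorff_ball A \<epsilon> \<subseteq> \<V>)"
      and A: "A \<in> \<U> \<inter> \<V>"
    obtain \<delta> \<epsilon> where "\<delta> > 0" "upper_hausdorff_ball A \<delta> \<subseteq> \<U>" "\<epsilon> > 0" "upper_hausdorff_ball A \<epsilon> \<subseteq> \<V>"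
      using U V A by blast
    moreover have "upper_hausdorff_ball A (min \<delta> \<epsilon>) \<subseteq> upper_hausdorff_ball A \<delta> \<inter> upper_hausdorff_ball A \<epsilon>"
      using enlargement_mono[of "min \<delta> \<epsilon>" \<delta> A] enlargement_mono[of "min \<delta> \<epsilon>" \<epsilon> A]
      by (auto simp: upper_hausdorff_ball_def)
    ultimately show "\<exists>\<epsilon>>0. upper_hausdorff_ball A \<epsilon> \<subseteq> \<U> \<inter> \<V>"
      by (intro exI[of _ "min \<delta> \<epsilon>"]) auto
  next
    fix \<K> A
    assume K: "\<forall>K\<in>\<K>. K \<subseteq> hyperspace \<and> (\<forall>A\<in>K. \<exists>\<epsilon>>0. upper_hausdorff_ball A \<epsilon> \<subseteq> K)"
      and "A \<in> \<Union>\<K>"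
    then obtain K \<epsilon> where "K \<in> \<K>" "\<epsilon> > 0" "upper_hausdorff_ball A \<epsilon> \<subseteq> K"
      by blast
    then show "\<exists>\<epsilon>>0. upper_hausdorff_ball A \<epsilon> \<subseteq> \<Union>\<K>"
      by blast
  qed auto
  then show ?thesis
    by (simp add: upper_hausdorff_def)
qed

lemma upper_hausdorff_ball_neighbourhood:
  assumes A: "A \<in> hyperspace" and "\<epsilon> > 0"
  shows "\<exists>\<U>. openin upper_hausdorff \<U> \<and> A \<in> \<U> \<and> \<U> \<subseteq> upper_hausdorff_ball A \<epsilon>"
proof (intro exI conjI)
  let ?U = "{C \<in> hyperspace. \<exists>\<delta>>0. enlargement C \<delta> \<subseteq> enlargement A \<epsilon>}"
  show "openin upper_hausdorff ?U"
    unfolding openin_upper_hausdorff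
  proof (intro conjI ballI)
    fix C assume "C \<in> ?U"
    then obtain \<delta> where \<delta>: "\<delta> > 0" "enlargement C \<delta> \<subseteq> enlargement A \<epsilon>"
      by blast
    have "upper_hausdorff_ball C (\<delta>/2) \<subseteq> ?U"
    proof
      fix D assume D: "D \<in> upper_hausdorff_ball C (\<delta>/2)"
      have "enlargement D (\<delta>/2) \<subseteq> enlargement (enlargement C (\<delta>/2)) (\<delta>/2)"
        using D unfolding upper_hausdorff_ball_def enlargement_def by blast
      also have "\<dots> \<subseteq> enlargement C \<delta>"
        using enlargement_enlargement[of C "\<delta>/2" "\<delta>/2"] by simp
      finally have "enlargement D (\<delta>/2) \<subseteq> enlargement A \<epsilon>"
        using \<delta> by blast
      then show "D \<in> ?U"
        using D \<delta>(1) by (auto simp: upper_hausdorff_ball_def intro!: exI[of _ "\<delta>/2"])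
    qed
    then show "\<exists>\<delta>>0. upper_hausdorff_ball C \<delta> \<subseteq> ?U"
      using \<delta>(1) by (intro exI[of _ "\<delta>/2"]) auto
  qed auto
  show "A \<in> ?U"
    using assms by blast
  show "?U \<subseteq> upper_hausdorff_ball A \<epsilon>"
  proof
    fix C assume "C \<in> ?U"
    then obtain \<delta> where "C \<in> hyperspace" "\<delta> > 0" "enlargement C \<delta> \<subseteq> enlargement A \<epsilon>"
      by blast
    moreover from \<open>C \<in> hyperspace\<close> have "C \<subseteq> M"
      by (rule hyperspace_subset)
    ultimately have "C \<subseteq> enlargement A \<epsilon>"
      using subset_enlargement by (meson subset_trans)
    with \<open>C \<in> hyperspace\<close> show "C \<in> upper_hausdorff_ball A \<epsilon>"
      by (simp add: upper_hausdorff_ball_def)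
  qed
qed

lemma topspace_upper_hausdorff: "topspace upper_hausdorff = hyperspace"
proof -
  have "upper_hausdorff_ball A 1 \<subseteq> hyperspace" for A
    by (auto simp: upper_hausdorff_ball_def)
  then have "openin upper_hausdorff hyperspace"
    unfolding openin_upper_hausdorff by (metis order_refl zero_less_one)
  moreover have "topspace upper_hausdorff \<subseteq> hyperspace"
    using openin_topspace[of upper_hausdorff] unfolding openin_upper_hausdorff by blast
  ultimately show ?thesis
    using openin_subset by (intro subset_antisym)
qed

lemma topspace_upper_vietoris: "topspace upper_vietoris = hyperspace"
proof
  show "topspace upper_vietoris \<subseteq> hyperspace"
  proof
    fix A assume "A \<in> topspace upper_vietoris"
    moreover have "(arbitrary union_of (\<lambda>\<U>. \<exists>U. openin mtopology U \<and> U \<noteq> {} \<and> \<U> = upper U))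
        (topspace upper_vietoris)"
      using openin_topspace[of upper_vietoris] by (simp only: openin_upper_vietoris)
    ultimately show "A \<in> hyperspace"
      unfolding arbitrary_union_of_alt upper_def by blast
  qed
next
  show "hyperspace \<subseteq> topspace upper_vietoris"
  proof
    fix C assume C: "C \<in> hyperspace"
    then have "M \<noteq> {}"
      using hyperspace_subset by (auto simp: hyperspace_def)
    moreover have "openin mtopology M"
      using openin_topspace[of mtopology] by simp
    ultimately have "openin upper_vietoris (upper M)"
      unfolding openin_upper_vietoris by (intro arbitrary_union_of_inc) blast
    then have "upper M \<subseteq> topspace upper_vietoris"
      by (rule openin_subset)
    then show "C \<in> topspace upper_vietoris"
      using C hyperspace_subset by (auto simp: upper_def)
  qed
qed

end

end

theory Submission
  imports Defs
begin

text \<open>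
  Property \<open>I\<close> of \<open>A\<close> says that every open \<open>U \<supseteq> A\<close> contains some
  \<open>\<epsilon>\<close>-enlargement of \<open>A\<close>. On the other hand, since singletons are closed, the
  upper Hausdorff ball of radius \<open>\<epsilon>\<close> about \<open>A\<close> lies in \<open>U\<^sup>+\<close> exactly when the
  \<open>\<epsilon>\<close>-enlargement of \<open>A\<close> lies in \<open>U\<close>.
\<close>

context Metric_space
begin

text \<open>A positive real lower bound \<epsilon> for all distances from points of \<open>A\<close>
  to points of \<open>M - U\<close> keeps the \<epsilon>-balls around \<open>A\<close> inside
  \<open>U\<close>, and conversely.\<close>

lemma property_I_iff_enlargement:
  "property_I A \<longleftrightarrow> A \<noteq> {} \<and> A \<subseteq> M \<and>
     (\<forall>U. openin mtopology U \<and> A \<subseteq> U \<longrightarrow> (\<exists>\<epsilon>>0. enlargement A \<epsilon> \<subseteq> U))"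
proof -
  have "(INF a\<in>A. point_set_dist a (M - U)) > 0 \<longleftrightarrow> (\<exists>\<epsilon>>0. enlargement A \<epsilon> \<subseteq> U)"
    if "A \<subseteq> M" for U
  proof
    assume "(INF a\<in>A. point_set_dist a (M - U)) > 0"
    \<comment> \<open>The infimum may be \<infinity>, for instance when \<open>U = M\<close>, so a
      real number strictly between 0 and it is taken.\<close>
    then obtain \<epsilon> where \<epsilon>: "\<epsilon> > 0" "ereal \<epsilon> < (INF a\<in>A. point_set_dist a (M - U))"
      using ereal_dense2 by (metis ereal_less(2))
    have "\<epsilon> < d a y" if "a \<in> A" "y \<in> M - U" for a y
    proof -
      have "ereal \<epsilon> < point_set_dist a (M - U)"
        using \<epsilon>(2) INF_lower[OF \<open>a \<in> A\<close>] by (rule less_le_trans)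
      also have "\<dots> \<le> ereal (d a y)"
        unfolding point_set_dist_def by (rule INF_lower[OF \<open>y \<in> M - U\<close>])
      finally show ?thesis
        by simp
    qed
    then have "enlargement A \<epsilon> \<subseteq> U"
      unfolding enlargement_def by force
    with \<epsilon>(1) show "\<exists>\<epsilon>>0. enlargement A \<epsilon> \<subseteq> U"
      by blast
  next
    assume "\<exists>\<epsilon>>0. enlargement A \<epsilon> \<subseteq> U"
    then obtain \<epsilon> where \<epsilon>: "\<epsilon> > 0" "enlargement A \<epsilon> \<subseteq> U"
      by blast
    \<comment> \<open>Otherwise \<open>y\<close> would lie in \<open>mball a \<epsilon>\<close>,
      hence in \<open>U\<close>; membership in the ball also requires \<open>a\<close> in
      \<open>M\<close>.\<close>
    then have "\<epsilon> \<le> d a y" if "a \<in> A" "y \<in> M - U" for a y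
      using that \<open>A \<subseteq> M\<close> by (force simp: enlargement_def)
    then have "ereal \<epsilon> \<le> (INF a\<in>A. point_set_dist a (M - U))"
      unfolding point_set_dist_def by (intro INF_greatest) simp
    then show "(INF a\<in>A. point_set_dist a (M - U)) > 0"
      using \<epsilon>(1) by (metis ereal_less(2) less_le_trans)
  qed
  then show ?thesis
    unfolding property_I_def by blast
qed

lemma upper_hausdorff_ball_subset_upper_iff:
  "upper_hausdorff_ball A \<epsilon> \<subseteq> upper U \<longleftrightarrow> enlargement A \<epsilon> \<subseteq> U"
proof
  assume *: "upper_hausdorff_ball A \<epsilon> \<subseteq> upper U"
  show "enlargement A \<epsilon> \<subseteq> U"
  proof
    fix x assume x: "x \<in> enlargement A \<epsilon>"
    then have "x \<in> M"
      by (auto simp: enlargement_def)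
    \<comment> \<open>The singleton \<open>{x}\<close> serves as a test set: it belongs to the
      hyperspace because metric spaces are Hausdorff.\<close>
    then have "closedin mtopology {x}"
      by (simp add: closedin_Hausdorff_singleton Hausdorff_space_mtopology)
    with x have "{x} \<in> upper_hausdorff_ball A \<epsilon>"
      by (simp add: upper_hausdorff_ball_def hyperspace_def)
    with * show "x \<in> U"
      by (auto simp: upper_def)
  qed
qed (auto simp: upper_hausdorff_ball_def upper_def)

text \<open>Comparing the topologies on the base suffices, since unions of open sets are
  open.\<close>

lemma upper_vietoris_le_iff:
  "(\<forall>\<U>. openin upper_vietoris \<U> \<longrightarrow> openin upper_hausdorff \<U>) \<longleftrightarrow>
     (\<forall>U. openin mtopology U \<and> U \<noteq> {} \<longrightarrow> openin upper_hausdorff (upper U))"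
proof (intro iffI allI impI)
  fix U
  assume *: "\<forall>\<U>. openin upper_vietoris \<U> \<longrightarrow> openin upper_hausdorff \<U>"
    and U: "openin mtopology U \<and> U \<noteq> {}"
  have "openin upper_vietoris (upper U)"
    unfolding openin_upper_vietoris using U by (intro arbitrary_union_of_inc) blast
  with * show "openin upper_hausdorff (upper U)"
    by blast
next
  fix \<U>
  assume *: "\<forall>U. openin mtopology U \<and> U \<noteq> {} \<longrightarrow> openin upper_hausdorff (upper U)"
    and "openin upper_vietoris \<U>"
  then obtain \<B> where "\<Union>\<B> = \<U>"
    and "\<And>\<V>. \<V> \<in> \<B> \<Longrightarrow> \<exists>U. openin mtopology U \<and> U \<noteq> {} \<and> \<V> = upper U"
    unfolding openin_upper_vietoris union_of_def by blast
  with * show "openin upper_hausdorff \<U>"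
    by (metis openin_Union)
qed

text \<open>Openness asks for a Hausdorff ball inside \<open>upper U\<close> around each of its
  members \<open>A\<close>, and such an inclusion is one of enlargements in
  \<open>U\<close>.\<close>

lemma openin_upper_hausdorff_upper_iff:
  "openin upper_hausdorff (upper U) \<longleftrightarrow>
     (\<forall>A\<in>hyperspace. A \<subseteq> U \<longrightarrow> (\<exists>\<epsilon>>0. enlargement A \<epsilon> \<subseteq> U))"
  by (auto simp: openin_upper_hausdorff upper_hausdorff_ball_subset_upper_iff)
     (auto simp: upper_def)

lemma upper_vietoris_le_iff_property_I:
  "(\<forall>\<U>. openin upper_vietoris \<U> \<longrightarrow> openin upper_hausdorff \<U>) \<longleftrightarrow>
     (\<forall>A\<in>hyperspace. property_I A)"
proof -
  have "A \<noteq> {} \<and> A \<subseteq> M" if "A \<in> hyperspace" for A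
    using that hyperspace_subset by (auto simp: hyperspace_def)
  then show ?thesis
    unfolding upper_vietoris_le_iff openin_upper_hausdorff_upper_iff property_I_iff_enlargement
    \<comment> \<open>Both sides now range over the same pairs \<open>A\<close>, \<open>U\<close>
      with \<open>A \<subseteq> U\<close>; the condition \<open>U \<noteq> {}\<close> is automatic
      because \<open>A\<close> is nonempty.\<close>
    by (metis subset_empty)
qed

end

theorem theorem4p4:
  fixes M :: "'a set" and d :: "'a \<Rightarrow> 'a \<Rightarrow> real"
  assumes "Metric_space M d"
  shows "{\<U>. openin (Metric_space.upper_vietoris M d) \<U>}
           \<subseteq> {\<U>. openin (Metric_space.upper_hausdorff M d) \<U>}
         \<longleftrightarrow> (\<forall>A. closedin (Metric_space.mtopology M d) A \<and> A \<noteq> {}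
                  \<longrightarrow> Metric_space.property_I M d A)"
proof -
  interpret Metric_space M d
    by (fact assms)
  show ?thesis
    using upper_vietoris_le_iff_property_I by (auto simp: hyperspace_def)
qed

end
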